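(* Let $f$ and $g$ be non-zero polynomials with real coefficients such that $f(x) = (c - x)^m g(x)$ for some positive real number $c$ and some positive integer $m$. Let $V(f)$ and $V(g)$ be the numbers of sign changes in the lists of coefficients of $f$ and $g$ respectively. Then $V(f) - V(g) - m$ is even and non-negative.
   Context: If $a_0, \ldots, a_n$ is a list of real numbers, the number of sign changes in it, written $V(a_0, \ldots, a_n)$, is the number of pairs of indices $(p, q)$ such that $p < q$, $a_p a_q < 0$ and $a_i = 0$ for all $p < i < q$. If $f(x) = a_0 + a_1 x + \ldots + a_n x^n$ is a polynomial with real coefficients, $V(f)$ denotes $V(a_0, \ldots, a_n)$. *)

theory Defs
  imports "HOL-Computational_Algebra.Polynomial" Complex_Main
begin

definition sign_changes :: "real list \<Rightarrow> nat" where
  "sign_changes as = card {(p, q). p < q \<and> q < length as \<and> as ! p * as ! q < 0 \<and>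
     (\<forall>i. p < i \<and> i < q \<longrightarrow> as ! i = 0)}"

definition poly_sign_changes :: "real poly \<Rightarrow> nat" where
  "poly_sign_changes f = sign_changes (coeffs f)"

end

theory Submission
  imports Defs
begin

text \<open>
  It suffices to treat one factor \<open>c - x\<close>. Prepend a nonzero number \<open>d\<close> to the coefficient list
  \<open>g\<^sub>0, g\<^sub>1, \<dots>\<close>; the list \<open>c g\<^sub>0 - d, c g\<^sub>1 - g\<^sub>0, \<dots>\<close> with \<open>d\<close> prepended has an odd number of sign
  changes more than \<open>d, g\<^sub>0, g\<^sub>1, \<dots>\<close>. This statement is local enough to be proved by induction on
  the list, and it yields the claim when \<open>d\<close> is the lowest nonzero coefficient, since \<open>c d\<close> and \<open>d\<close>
  have the same sign.
\<close>

section \<open>Counting sign changes in one pass through a list\<close>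

text \<open>\<open>s\<close> is the last nonzero entry passed so far; the value 0 means none yet,
  since a product with 0 is never negative.\<close>

fun sign_changes_from :: "real \<Rightarrow> real list \<Rightarrow> nat" where
  "sign_changes_from s [] = 0"
| "sign_changes_from s (a # as) =
     (if a = 0 then sign_changes_from s as else of_bool (s * a < 0) + sign_changes_from a as)"

text \<open>Only the first nonzero entry of \<open>as\<close> is compared with the start value, so
  the set has at most one element, and behind that entry both counts agree.\<close>

lemma card_first_nonzero_opposite:
  "card {q. q < length as \<and> s * as ! q < 0 \<and> (\<forall>i<q. as ! i = 0)} + sign_changes_from 0 as
     = sign_changes_from s as"
proof (induction as)
  case Nil
  show ?case by simp
next
  case (Cons a as)
  let ?C = "\<lambda>as. {q. q < length as \<and> s * as ! q < 0 \<and> (\<forall>i<q. as ! i = 0)}"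
  show ?case
  proof (cases "a = 0")
    case True
    have "?C (a # as) = Suc ` ?C as"
    proof (intro set_eqI)
      fix q
      show "q \<in> ?C (a # as) \<longleftrightarrow> q \<in> Suc ` ?C as"
        using True by (cases q) (auto simp: image_iff All_less_Suc2)
    qed
    then show ?thesis
      using True Cons.IH by (simp add: card_image)
  next
    case False
    have "q \<in> ?C (a # as) \<longleftrightarrow> q = 0 \<and> s * a < 0" for q
      using False by (cases q) (auto simp: All_less_Suc2)
    then have "?C (a # as) = (if s * a < 0 then {0} else {})"
      by auto
    then show ?thesis
      using False by simp
  qed
qed

text \<open>The pairs starting at the new head are split off; all others are pairs of
  \<open>as\<close> with both indices shifted by one.\<close>

lemma sign_changes_Cons:
  "sign_changes (a # as) =
     card {q. q < length as \<and> a * as ! q < 0 \<and> (\<forall>i<q. as ! i = 0)} + sign_changes as"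
proof -
  define S where "S = (\<lambda>as :: real list. {(p, q). p < q \<and> q < length as \<and> as ! p * as ! q < 0 \<and>
     (\<forall>i. p < i \<and> i < q \<longrightarrow> as ! i = 0)})"
  let ?C = "{q. q < length as \<and> a * as ! q < 0 \<and> (\<forall>i<q. as ! i = 0)}"
  have "finite (S as)"
    by (rule finite_subset[of _ "{..<length as} \<times> {..<length as}"]) (auto simp: S_def)
  moreover have "S (a # as) = (\<lambda>q. (0, Suc q)) ` ?C \<union> map_prod Suc Suc ` S as"
  proof (intro set_eqI)
    fix z :: "nat \<times> nat"
    obtain p q where z: "z = (p, q)" by (cases z)
    have all_shift: "(\<forall>i. Suc k < i \<and> i < Suc l \<longrightarrow> (a # as) ! i = 0) \<longleftrightarrow>
        (\<forall>i. k < i \<and> i < l \<longrightarrow> as ! i = 0)" for k l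
      by (auto simp: nth_Cons split: nat.splits)
    have all_shift0: "(\<forall>i. 0 < i \<and> i < Suc l \<longrightarrow> (a # as) ! i = 0) \<longleftrightarrow> (\<forall>i<l. as ! i = 0)" for l
      by (auto simp: nth_Cons split: nat.splits)
    show "z \<in> S (a # as) \<longleftrightarrow> z \<in> (\<lambda>q. (0, Suc q)) ` ?C \<union> map_prod Suc Suc ` S as"
    proof (cases q)
      case 0
      then show ?thesis by (auto simp: z S_def)
    next
      case (Suc l)
      show ?thesis
      proof (cases p)
        case 0
        have "z \<in> S (a # as) \<longleftrightarrow> l \<in> ?C"
          using all_shift0[of l] by (simp add: z S_def Suc 0)
        then show ?thesis by (auto simp: z Suc 0)
      next
        case (Suc k)
        have "z \<in> S (a # as) \<longleftrightarrow> (k, l) \<in> S as"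
          using all_shift[of k l] by (simp add: z S_def Suc \<open>q = Suc l\<close>)
        then show ?thesis by (auto simp: z Suc \<open>q = Suc l\<close>)
      qed
    qed
  qed
  moreover have "card ((\<lambda>q. (0, Suc q)) ` ?C) = card ?C"
    by (rule card_image) (auto simp: inj_on_def)
  moreover have "card (map_prod Suc Suc ` S as) = card (S as)"
    by (rule card_image) (auto simp: inj_on_def)
  moreover have "(\<lambda>q. (0, Suc q)) ` ?C \<inter> map_prod Suc Suc ` S as = {}"
    by auto
  ultimately have "card (S (a # as)) = card ?C + card (S as)"
    by (simp add: card_Un_disjoint)
  then show ?thesis
    by (simp add: sign_changes_def S_def)
qed

lemma sign_changes_eq_from: "sign_changes as = sign_changes_from 0 as"
proof (induction as)
  case Nil
  show ?case by (simp add: sign_changes_def)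
next
  case (Cons a as)
  then show ?case
    using card_first_nonzero_opposite[of as a] by (simp add: sign_changes_Cons)
qed

lemma sign_changes_from_same_sign:
  assumes "s * t > 0"
  shows "sign_changes_from s as = sign_changes_from t as"
proof (induction as)
  case (Cons a as)
  have "s * a < 0 \<longleftrightarrow> t * a < 0"
    using assms by (auto simp: zero_less_mult_iff mult_less_0_iff)
  with Cons show ?case by simp
qed simp

text \<open>The first nonzero entry differs in sign from exactly one of \<open>s\<close> and
  \<open>t\<close>; without such an entry both counts vanish.\<close>

lemma sign_changes_from_opposite_sign:
  assumes "s * t < 0"
  shows "sign_changes_from s as = 0 \<and> sign_changes_from t as = 0 \<or>
         sign_changes_from s as = Suc (sign_changes_from t as) \<or>
         sign_changes_from t as = Suc (sign_changes_from s as)"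
proof (induction as)
  case (Cons a as)
  have "a \<noteq> 0 \<Longrightarrow> s * a < 0 \<longleftrightarrow> \<not> t * a < 0"
    using assms by (auto simp: mult_less_0_iff)
  with Cons show ?case by auto
qed simp

lemma sign_changes_from_zeros: "set as \<subseteq> {0} \<Longrightarrow> sign_changes_from s as = 0"
  by (induction as) auto

section \<open>One linear factor, on the level of lists\<close>

text \<open>Coefficients of \<open>(c - x) g(x) - d\<close>.\<close>
fun times_linear_coeffs :: "real \<Rightarrow> real \<Rightarrow> real list \<Rightarrow> real list" where
  "times_linear_coeffs c d [] = [- d]"
| "times_linear_coeffs c d (b # bs) = (c * b - d) # times_linear_coeffs c b bs"

lemma times_linear_coeffs_zeros: "set bs \<subseteq> {0} \<Longrightarrow> set (times_linear_coeffs c 0 bs) \<subseteq> {0}"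
  by (induction bs) auto

text \<open>The claims need each other: a zero coefficient \<open>b\<close> makes the carried value
  0, and a nonzero \<open>b\<close> after that leads back to the first claim with \<open>b\<close>
  for \<open>d\<close>. In the second claim \<open>s\<close> is free, because the last nonzero entry
  may lie behind a run of zeros.\<close>

lemma sign_changes_from_times_linear:
  assumes c: "c > 0"
  shows sign_changes_from_times_linear_nonzero:
      "d \<noteq> 0 \<Longrightarrow> \<exists>k. sign_changes_from d (times_linear_coeffs c d bs)
         = sign_changes_from d bs + 1 + 2 * k" (is "_ \<Longrightarrow> ?P d bs")
    and sign_changes_from_times_linear_zero:
      "\<not> set bs \<subseteq> {0} \<Longrightarrow> \<exists>k. sign_changes_from s (times_linear_coeffs c 0 bs)
         = sign_changes_from s bs + 1 + 2 * k" (is "_ \<Longrightarrow> ?Q s bs")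
proof (induction bs arbitrary: d s)
  case Nil
  {
    case 1
    then show ?case by (auto simp: zero_less_mult_iff)
  next
    case 2
    then show ?case by simp
  }
next
  case (Cons b bs)
  {
    case 1
    show ?case
    proof (cases "b = 0")
      case b: True
      \<comment> \<open>The entry here is \<open>- d\<close>, a change against \<open>d\<close>. The
        rest of the new list is counted from \<open>- d\<close>, that of the old list still from
        \<open>d\<close>.\<close>
      have neg: "d * (- d) < 0"
        using 1 by (auto simp: zero_less_mult_iff)
      show ?thesis
      proof (cases "set bs \<subseteq> {0}")
        case True
        then show ?thesis
          using b 1 neg times_linear_coeffs_zeros[OF True, of c]
          by (simp add: sign_changes_from_zeros)
      next
        case False
        then obtain k where k: "sign_changes_from d (times_linear_coeffs c 0 bs)
            = sign_changes_from d bs + 1 + 2 * k"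
          using Cons.IH(2) by blast
        have lhs: "sign_changes_from d (times_linear_coeffs c d (b # bs))
            = 1 + sign_changes_from (- d) (times_linear_coeffs c 0 bs)"
          using b 1 neg by simp
        have rhs: "sign_changes_from d (b # bs) = sign_changes_from d bs"
          using b by simp
        \<comment> \<open>By \<open>k\<close> the count from \<open>d\<close> is positive, so
          passing to \<open>- d\<close> shifts it by exactly one. With the change at
          \<open>- d\<close> the excess is \<open>1 + 2 * k\<close> or
          \<open>3 + 2 * k\<close>.\<close>
        show ?thesis
          using k sign_changes_from_opposite_sign[OF neg, of "times_linear_coeffs c 0 bs"]
          unfolding lhs rhs by presburger
      qed
    next
      case b: False
      let ?X = "times_linear_coeffs c b bs"
      let ?e = "c * b - d"
      obtain k where k: "sign_changes_from b ?X = sign_changes_from b bs + 1 + 2 * k"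
        using Cons.IH(1)[OF b] by blast
      have rhs: "sign_changes_from d (b # bs) = of_bool (d * b < 0) + sign_changes_from b bs"
        using b by simp
      \<comment> \<open>\<open>y\<close> stands for \<open>c * b\<close>, of which only the sign
        matters. The cases compare the sign of the new entry with that of \<open>b\<close>.\<close>
      have "y - d = 0 \<and> d * b > 0 \<or> (y - d) * b > 0 \<and> (d * (y - d) < 0 \<longleftrightarrow> d * b < 0) \<or>
          (y - d) * b < 0 \<and> d * b > 0 \<and> d * (y - d) < 0"
        if "y > 0 \<longleftrightarrow> b > 0" "y < 0 \<longleftrightarrow> b < 0" for y
        using that 1 b unfolding mult_less_0_iff zero_less_mult_iff by linarith
      moreover have "c * b > 0 \<longleftrightarrow> b > 0" "c * b < 0 \<longleftrightarrow> b < 0"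
        using c by (auto simp: mult_less_0_iff zero_less_mult_iff)
      ultimately have "?e = 0 \<and> d * b > 0 \<or> ?e * b > 0 \<and> (d * ?e < 0 \<longleftrightarrow> d * b < 0) \<or>
          ?e * b < 0 \<and> d * b > 0 \<and> d * ?e < 0"
        by blast
      then consider (zero) "?e = 0" "d * b > 0"
        | (same) "?e * b > 0" "d * ?e < 0 \<longleftrightarrow> d * b < 0"
        | (opposite) "?e * b < 0" "d * b > 0" "d * ?e < 0"
        by blast
      then show ?thesis
      proof cases
        case zero
        \<comment> \<open>The vanishing entry is skipped, so the start value remains
          \<open>d\<close>, which has the sign of \<open>b\<close>.\<close>
        then have "sign_changes_from d ?X = sign_changes_from b ?X"
          by (intro sign_changes_from_same_sign)
        with zero k rhs show ?thesis by auto
      next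
        case same
        then have "sign_changes_from ?e ?X = sign_changes_from b ?X"
          by (intro sign_changes_from_same_sign)
        moreover have "?e \<noteq> 0" using same by auto
        ultimately show ?thesis using same k rhs by auto
      next
        case opposite
        \<comment> \<open>Here \<open>?e\<close> adds a change that \<open>b\<close> does not, and
          continuing from \<open>?e\<close> instead of \<open>b\<close> shifts the count by one up
          or down, so the excess stays odd and positive.\<close>
        have "?e \<noteq> 0" using opposite by auto
        then have lhs: "sign_changes_from d (times_linear_coeffs c d (b # bs))
            = 1 + sign_changes_from ?e ?X"
          using opposite by simp
        have rhs': "sign_changes_from d (b # bs) = sign_changes_from b bs"
          using rhs opposite by simp
        show ?thesis
          using k sign_changes_from_opposite_sign[OF opposite(1), of ?X]
          unfolding lhs rhs' by presburger
      qed
    qed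
  next
    case 2
    show ?case
    proof (cases "b = 0")
      case True
      then show ?thesis using 2 Cons.IH(2)[of s] by simp
    next
      case b: False
      \<comment> \<open>The first nonzero entry of the product is \<open>c * b\<close>; it can be
        replaced by \<open>b\<close>, and the first claim applies behind it.\<close>
      have "sign_changes_from (c * b) (times_linear_coeffs c b bs)
          = sign_changes_from b (times_linear_coeffs c b bs)"
        using b c by (intro sign_changes_from_same_sign) (auto simp: zero_less_mult_iff mult_less_0_iff)
      moreover have "s * (c * b) < 0 \<longleftrightarrow> s * b < 0"
        using c by (auto simp: mult_less_0_iff zero_less_mult_iff)
      ultimately show ?thesis
        using Cons.IH(1)[OF b] b c by auto
    qed
  }
qed

section \<open>From lists back to polynomials\<close>

lemma last_times_linear_coeffs: "last (times_linear_coeffs c d bs) = - last (d # bs)"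
proof (induction bs arbitrary: d)
  case (Cons b bs)
  have "times_linear_coeffs c b bs \<noteq> []"
    by (cases bs) auto
  with Cons show ?case by simp
qed simp

lemma Poly_times_linear_coeffs:
  "Poly (times_linear_coeffs c d bs) = smult c (Poly bs) - pCons d (Poly bs)"
  by (induction bs arbitrary: d) simp_all

text \<open>The last entry of the list is minus the leading coefficient of \<open>g\<close>, so
  there are no trailing zeros to strip.\<close>

lemma coeffs_linear_times:
  assumes "g \<noteq> 0"
  shows "coeffs (([:c:] - [:0, 1:]) * g) = times_linear_coeffs c 0 (coeffs g)"
proof -
  have "coeffs g \<noteq> []" "last (coeffs g) \<noteq> 0"
    using assms by (auto simp: last_coeffs_eq_coeff_degree)
  then have "last (times_linear_coeffs c 0 (coeffs g)) \<noteq> 0"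
    by (simp add: last_times_linear_coeffs)
  then have "coeffs (Poly (times_linear_coeffs c 0 (coeffs g))) = times_linear_coeffs c 0 (coeffs g)"
    by (simp add: strip_while_idem_iff no_trailing_unfold)
  moreover have "([:c:] - [:0, 1:]) * g = smult c g - pCons 0 g"
    unfolding left_diff_distrib by simp
  ultimately show ?thesis
    by (simp only: Poly_times_linear_coeffs Poly_coeffs)
qed

lemma poly_sign_changes_linear_times:
  assumes "c > 0" and "g \<noteq> 0"
  shows "\<exists>k. poly_sign_changes (([:c:] - [:0, 1:]) * g) = poly_sign_changes g + 1 + 2 * k"
proof -
  have "last (coeffs g) \<in> set (coeffs g)" "last (coeffs g) \<noteq> 0"
    using assms(2) last_in_set[of "coeffs g"] by (auto simp: last_coeffs_eq_coeff_degree)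
  then have "\<not> set (coeffs g) \<subseteq> {0}"
    by blast
  then show ?thesis
    unfolding poly_sign_changes_def sign_changes_eq_from coeffs_linear_times[OF assms(2)]
    by (rule sign_changes_from_times_linear_zero[OF assms(1)])
qed

lemma poly_sign_changes_linear_power_times:
  assumes "c > 0" and "g \<noteq> 0"
  shows "\<exists>k. poly_sign_changes (([:c:] - [:0, 1:]) ^ m * g) = poly_sign_changes g + m + 2 * k"
proof (induction m)
  case (Suc m)
  have "([:c:] - [:0, 1:]) ^ m * g \<noteq> 0"
    using assms by simp
  from poly_sign_changes_linear_times[OF assms(1) this]
  obtain j where "poly_sign_changes (([:c:] - [:0, 1:]) ^ Suc m * g)
      = poly_sign_changes (([:c:] - [:0, 1:]) ^ m * g) + 1 + 2 * j"
    unfolding power_Suc mult.assoc by blast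
  moreover obtain k where
    "poly_sign_changes (([:c:] - [:0, 1:]) ^ m * g) = poly_sign_changes g + m + 2 * k"
    using Suc by blast
  ultimately have "poly_sign_changes (([:c:] - [:0, 1:]) ^ Suc m * g)
      = poly_sign_changes g + Suc m + 2 * (k + j)"
    by presburger
  then show ?case by blast
qed simp

theorem lemma2:
  fixes f g :: "real poly" and c :: real and m :: nat
  assumes "f \<noteq> 0" and "g \<noteq> 0"
    and "c > 0" and "m > 0"
    and "f = ([:c:] - [:0, 1:]) ^ m * g"
  shows "even (int (poly_sign_changes f) - int (poly_sign_changes g) - int m) \<and>
         int (poly_sign_changes f) - int (poly_sign_changes g) - int m \<ge> 0"
proof -
  obtain k where "poly_sign_changes f = poly_sign_changes g + m + 2 * k"
    using poly_sign_changes_linear_power_times[OF assms(3,2)] assms(5) by blast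
  then show ?thesis by simp
qed

end
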